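(* Let $R\in(0,1]$, $\alpha\in\mathbb{R}$, and let $u\ge 0$ be a distributional solution to $$-u''-\frac14\,t^{-2}u\ \ge\ \alpha\,t^{-2}|\log t|^{-2}u\qquad\text{in }\mathcal{D}'(0,R).$$ Assume that there exists $\gamma\le 1$ such that $$u\in L^2\bigl((0,R);t^{-2}|\log t|^{-2\gamma}\,dt\bigr),\qquad \alpha\ge\frac14-(1-\gamma)^2.$$ Then $u=0$ almost everywhere in $(0,R)$.
   Context: A distributional solution is a function $u\in L^1_{\rm loc}(0,R)$ such that $$-\int_0^R u\varphi''\,dt-\frac14\int_0^R t^{-2}u\varphi\,dt\ \ge\ \alpha\int_0^R t^{-2}|\log t|^{-2}u\varphi\,dt$$ for every non-negative $\varphi\in C^\infty_c(0,R)$. For a non-negative measurable weight $\omega$, $L^2((0,R);\omega(t)\,dt)$ is the space of measurable $u$ with $\int_0^R|u|^2\omega\,dt<\infty$. *)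

theory Defs
  imports "HOL-Analysis.Analysis"
begin

(* C_c^infinity(S) for open S: such functions are represented by their extension by zero
   to the whole real line. *)
definition test_function_on :: "real set \<Rightarrow> (real \<Rightarrow> real) \<Rightarrow> bool" where
  "test_function_on S \<phi> \<longleftrightarrow>
     (\<forall>n. (deriv ^^ n) \<phi> differentiable_on UNIV) \<and>
     compact (closure {t. \<phi> t \<noteq> 0}) \<and> closure {t. \<phi> t \<noteq> 0} \<subseteq> S"

definition locally_integrable_on :: "(real \<Rightarrow> real) \<Rightarrow> real set \<Rightarrow> bool" where
  "locally_integrable_on u S \<longleftrightarrow> (\<forall>K. compact K \<and> K \<subseteq> S \<longrightarrow> set_integrable lebesgue K u)"

(* u is a distributional solution of -u'' - u / (4 t^2) >= alpha t^(-2) |log t|^(-2) u on (0,R).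
   For 0 < R <= 1 the coefficients are bounded on compact subsets of (0,R), so all integrals
   below are integrals of integrable functions. *)
definition distributional_solution :: "real \<Rightarrow> real \<Rightarrow> (real \<Rightarrow> real) \<Rightarrow> bool" where
  "distributional_solution R \<alpha> u \<longleftrightarrow>
     locally_integrable_on u {0<..<R} \<and>
     (\<forall>\<phi>. test_function_on {0<..<R} \<phi> \<and> (\<forall>t. 0 \<le> \<phi> t) \<longrightarrow>
        - (LINT t:{0<..<R}|lebesgue. u t * deriv (deriv \<phi>) t)
          - 1/4 * (LINT t:{0<..<R}|lebesgue. t powi (-2) * u t * \<phi> t)
        \<ge> \<alpha> * (LINT t:{0<..<R}|lebesgue. t powi (-2) * \<bar>ln t\<bar> powi (-2) * u t * \<phi> t))"

definition weighted_L2 :: "real set \<Rightarrow> (real \<Rightarrow> real) \<Rightarrow> (real \<Rightarrow> real) set" where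
  "weighted_L2 S \<omega> =
     {u. set_borel_measurable lebesgue S u \<and>
         (\<integral>\<^sup>+t\<in>S. ennreal (\<bar>u t\<bar>\<^sup>2 * \<omega> t) \<partial>lebesgue) < \<infinity>}"

end

theory Submission
  imports Defs "HOL-Real_Asymp.Real_Asymp"
begin

text \<open>
  Put \<open>x = ln (- ln t)\<close>, \<open>\<delta> = 1 - \<gamma> \<ge> 0\<close> and \<open>u = h z\<close> with \<open>h = t\<^sup>1\<^sup>/\<^sup>2 \<bar>ln t\<bar> powr (1/2 - \<delta>)\<close>. Since \<open>h\<close> solves
  \<open>-h'' - h/(4t\<^sup>2) = (1/4 - \<delta>\<^sup>2) t\<^sup>-\<^sup>2 \<bar>ln t\<bar>\<^sup>-\<^sup>2 h\<close>, the inequality for \<open>u\<close> gives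
  \<open>(exp (-2\<delta>x) z')' \<le> 0\<close> in the variable \<open>x\<close>, while the weighted integrability of \<open>u\<close> says
  \<open>z \<in> L\<^sup>2(dx)\<close> on a half-line unbounded to the right. If \<open>z' < 0\<close> somewhere, then \<open>z\<close> would
  eventually become negative; so \<open>z \<ge> 0\<close> is nondecreasing and square integrable, hence zero.
  In weak form: for a bump \<open>\<rho>\<close> and every \<open>b \<ge> 0\<close> a suitable test function yields
  \<open>\<integral> z \<rho> \<le> 2 \<integral> z \<rho>(\<cdot> - b)\<close>, and the right-hand side tends to \<open>0\<close> as \<open>b \<rightarrow> \<infinity>\<close>.
\<close>

subsection \<open>Smooth functions on open sets\<close>

text \<open>The iterates of the total operator \<open>deriv\<close> are the same ones that
  \<open>test_function_on\<close> uses, so smoothness on the whole line is directly its first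
  condition. With \<open>k<n\<close> the derivatives up to order \<open>n\<close> exist, the last
  one without continuity.\<close>

definition times_differentiable_on :: "nat \<Rightarrow> real set \<Rightarrow> (real \<Rightarrow> real) \<Rightarrow> bool" where
  "times_differentiable_on n S f \<longleftrightarrow> (\<forall>k<n. \<forall>x\<in>S. (deriv ^^ k) f differentiable (at x))"

definition smooth_on :: "real set \<Rightarrow> (real \<Rightarrow> real) \<Rightarrow> bool" where
  "smooth_on S f \<longleftrightarrow> (\<forall>n. times_differentiable_on n S f)"

lemma times_differentiable_on_0 [simp]: "times_differentiable_on 0 S f"
  by (simp add: times_differentiable_on_def)

lemma times_differentiable_on_Suc_iff:
  "times_differentiable_on (Suc n) S f \<longleftrightarrow>
     (\<forall>x\<in>S. f differentiable (at x)) \<and> times_differentiable_on n S (deriv f)"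
proof -
  have "(\<forall>k<Suc n. P k) \<longleftrightarrow> P 0 \<and> (\<forall>k<n. P (Suc k))" for P :: "nat \<Rightarrow> bool"
    by (metis less_Suc_eq_0_disj)
  then show ?thesis
    by (simp add: times_differentiable_on_def funpow_swap1)
qed

lemma times_differentiable_on_lower:
  "times_differentiable_on n S f \<Longrightarrow> m \<le> n \<Longrightarrow> times_differentiable_on m S f"
  by (auto simp: times_differentiable_on_def)

lemma times_differentiable_on_subset:
  "times_differentiable_on n S f \<Longrightarrow> T \<subseteq> S \<Longrightarrow> times_differentiable_on n T f"
  by (auto simp: times_differentiable_on_def)

lemma times_differentiable_on_Un:
  "times_differentiable_on n S f \<Longrightarrow> times_differentiable_on n T f
    \<Longrightarrow> times_differentiable_on n (S \<union> T) f"
  by (auto simp: times_differentiable_on_def)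

lemma has_derivative_deriv_if_Suc:
  "times_differentiable_on (Suc n) S f \<Longrightarrow> x \<in> S \<Longrightarrow> (f has_real_derivative deriv f x) (at x)"
  by (simp add: times_differentiable_on_Suc_iff DERIV_deriv_iff_real_differentiable)

text \<open>Openness makes \<open>f\<close> and \<open>g\<close> agree near each point of
  \<open>S\<close>. Their derivatives then agree on \<open>S\<close> again, so the induction can
  pass to the pair of derivatives.\<close>

lemma times_differentiable_on_cong:
  assumes "open S" and "\<And>x. x \<in> S \<Longrightarrow> f x = g x" and "times_differentiable_on n S f"
  shows "times_differentiable_on n S g"
  using assms(2,3)
proof (induction n arbitrary: f g)
  case (Suc n)
  have D: "(g has_real_derivative deriv f x) (at x)" if "x \<in> S" for x
    using has_derivative_deriv_if_Suc[OF Suc.prems(2) that]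
      has_field_derivative_transform_within_open[OF _ \<open>open S\<close> that] Suc.prems(1) by blast
  have "times_differentiable_on n S (deriv g)"
    using Suc.IH[of "deriv f" "deriv g"] Suc.prems(2) D DERIV_imp_deriv
    by (metis times_differentiable_on_Suc_iff)
  then show ?case
    using D by (auto simp: times_differentiable_on_Suc_iff real_differentiable_def)
qed auto

text \<open>This is the induction step of all closure rules below: an explicit formula, known only
  on \<open>S\<close>, may replace the total function \<open>deriv f\<close>.\<close>

lemma times_differentiable_on_SucI:
  assumes "open S" and D: "\<And>x. x \<in> S \<Longrightarrow> (f has_real_derivative f' x) (at x)"
    and f': "times_differentiable_on n S f'"
  shows "times_differentiable_on (Suc n) S f"
proof -
  have "times_differentiable_on n S (deriv f)"
    by (rule times_differentiable_on_cong[OF \<open>open S\<close> _ f']) (metis D DERIV_imp_deriv)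
  then show ?thesis
    using D by (auto simp: times_differentiable_on_Suc_iff real_differentiable_def)
qed

lemma times_differentiable_on_const: "times_differentiable_on n S (\<lambda>x. c)"
proof (induction n arbitrary: c)
  case (Suc n)
  have "deriv (\<lambda>x::real. c) = (\<lambda>x. 0)"
    by auto
  then show ?case
    using Suc[of 0] by (simp add: times_differentiable_on_Suc_iff)
qed simp

lemma times_differentiable_on_ident: "open S \<Longrightarrow> times_differentiable_on n S (\<lambda>x. x)"
  by (cases n) (auto intro!: times_differentiable_on_SucI[where f' = "\<lambda>x. 1"]
      times_differentiable_on_const derivative_eq_intros)

lemma times_differentiable_on_add:
  assumes "open S"
  shows "times_differentiable_on n S f \<Longrightarrow> times_differentiable_on n S g
    \<Longrightarrow> times_differentiable_on n S (\<lambda>x. f x + g x)"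
proof (induction n arbitrary: f g)
  case (Suc n)
  show ?case
    by (rule times_differentiable_on_SucI[OF assms, where f' = "\<lambda>x. deriv f x + deriv g x"])
      (use Suc in \<open>auto intro!: derivative_intros Suc.IH dest: has_derivative_deriv_if_Suc
        simp: times_differentiable_on_Suc_iff DERIV_deriv_iff_real_differentiable\<close>)
qed simp

lemma times_differentiable_on_mult:
  assumes "open S"
  shows "times_differentiable_on n S f \<Longrightarrow> times_differentiable_on n S g
    \<Longrightarrow> times_differentiable_on n S (\<lambda>x. f x * g x)"
proof (induction n arbitrary: f g)
  case (Suc n)
  \<comment> \<open>The product rule leaves one factor undifferentiated, so the induction hypothesis
    is applied to \<open>f\<close> and \<open>g\<close> themselves at the lower order
    \<open>n\<close>.\<close>
  have low: "times_differentiable_on n S f" "times_differentiable_on n S g"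
    "times_differentiable_on n S (deriv f)" "times_differentiable_on n S (deriv g)"
    using Suc.prems times_differentiable_on_lower[OF _ le_SucI[OF order_refl]]
    by (auto simp: times_differentiable_on_Suc_iff)
  show ?case
    by (rule times_differentiable_on_SucI[OF assms,
          where f' = "\<lambda>x. deriv f x * g x + deriv g x * f x"])
      (use Suc.prems low in \<open>auto intro!: DERIV_mult Suc.IH times_differentiable_on_add[OF assms]
          has_derivative_deriv_if_Suc\<close>)
qed simp

lemma times_differentiable_on_compose:
  assumes "open S" and "\<And>x. x \<in> S \<Longrightarrow> g x \<in> T"
  shows "times_differentiable_on n T f \<Longrightarrow> times_differentiable_on n S g
    \<Longrightarrow> times_differentiable_on n S (\<lambda>x. f (g x))"
proof (induction n arbitrary: f)
  case (Suc n)
  have low: "times_differentiable_on n S g"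
    "times_differentiable_on n T (deriv f)" "times_differentiable_on n S (deriv g)"
    using Suc.prems times_differentiable_on_lower[OF _ le_SucI[OF order_refl]]
    by (auto simp: times_differentiable_on_Suc_iff)
  show ?case
    by (rule times_differentiable_on_SucI[OF assms(1),
          where f' = "\<lambda>x. deriv f (g x) * deriv g x"])
      (use Suc.prems low assms in \<open>auto intro!: DERIV_chain2[of f _ g] Suc.IH
          times_differentiable_on_mult[OF assms(1)] has_derivative_deriv_if_Suc\<close>)
qed simp

lemma smooth_on_cong:
  "open S \<Longrightarrow> (\<And>x. x \<in> S \<Longrightarrow> f x = g x) \<Longrightarrow> smooth_on S f \<Longrightarrow> smooth_on S g"
  unfolding smooth_on_def by (blast intro: times_differentiable_on_cong)

lemma smooth_on_Un: "smooth_on S f \<Longrightarrow> smooth_on T f \<Longrightarrow> smooth_on (S \<union> T) f"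
  unfolding smooth_on_def by (blast intro: times_differentiable_on_Un)

lemma smooth_on_antiderivative:
  assumes "open S" and "\<And>x. x \<in> S \<Longrightarrow> (f has_real_derivative f' x) (at x)" and "smooth_on S f'"
  shows "smooth_on S f"
  using times_differentiable_on_SucI[OF assms(1,2)] assms(3)
    times_differentiable_on_lower[OF _ le_SucI[OF order_refl]]
  unfolding smooth_on_def by blast

lemma smooth_on_const: "smooth_on S (\<lambda>x. c)"
  by (simp add: smooth_on_def times_differentiable_on_const)

lemma smooth_on_ident: "open S \<Longrightarrow> smooth_on S (\<lambda>x. x)"
  by (simp add: smooth_on_def times_differentiable_on_ident)

lemma smooth_on_add:
  "open S \<Longrightarrow> smooth_on S f \<Longrightarrow> smooth_on S g \<Longrightarrow> smooth_on S (\<lambda>x. f x + g x)"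
  by (simp add: smooth_on_def times_differentiable_on_add)

lemma smooth_on_mult:
  "open S \<Longrightarrow> smooth_on S f \<Longrightarrow> smooth_on S g \<Longrightarrow> smooth_on S (\<lambda>x. f x * g x)"
  by (simp add: smooth_on_def times_differentiable_on_mult)

lemma smooth_on_minus: "open S \<Longrightarrow> smooth_on S f \<Longrightarrow> smooth_on S (\<lambda>x. - f x)"
  using smooth_on_mult[OF _ smooth_on_const[of S "-1"], of f] by simp

lemma smooth_on_diff:
  "open S \<Longrightarrow> smooth_on S f \<Longrightarrow> smooth_on S g \<Longrightarrow> smooth_on S (\<lambda>x. f x - g x)"
  using smooth_on_add[OF _ _ smooth_on_minus, of S f g] by simp

lemma smooth_on_compose:
  assumes "smooth_on T f" and "open S" and "smooth_on S g" and "\<And>x. x \<in> S \<Longrightarrow> g x \<in> T"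
  shows "smooth_on S (\<lambda>x. f (g x))"
  using times_differentiable_on_compose[of S g T, OF assms(2,4)] assms(1,3)
  by (simp add: smooth_on_def)

lemma smooth_on_exp: "smooth_on S (exp :: real \<Rightarrow> real)"
proof -
  have "times_differentiable_on n UNIV (exp :: real \<Rightarrow> real)" for n
    by (induction n) (auto intro!: times_differentiable_on_SucI[where f' = exp] DERIV_exp)
  then show ?thesis
    using times_differentiable_on_subset unfolding smooth_on_def by blast
qed

lemma smooth_on_inverse: "smooth_on {0<..} (inverse :: real \<Rightarrow> real)"
proof -
  have "times_differentiable_on n {0<..} (inverse :: real \<Rightarrow> real)" for n
  proof (induction n)
    case (Suc n)
    have D: "(inverse has_real_derivative (-1) * (inverse x * inverse x)) (at x)"
      if "x \<in> {0<..}" for x :: real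
      using that by (auto intro!: derivative_eq_intros)
    show ?case
      by (intro times_differentiable_on_SucI[OF open_greaterThan D] times_differentiable_on_mult
          times_differentiable_on_const Suc open_greaterThan)
  qed simp
  then show ?thesis by (simp add: smooth_on_def)
qed

lemma smooth_on_ln: "smooth_on {0<..} (ln :: real \<Rightarrow> real)"
  by (rule smooth_on_antiderivative[OF _ _ smooth_on_inverse])
    (auto intro!: derivative_eq_intros simp: inverse_eq_divide)

lemmas smooth_on_intros = smooth_on_const smooth_on_ident smooth_on_add smooth_on_mult
  smooth_on_diff smooth_on_minus smooth_on_compose[OF smooth_on_exp]

section \<open>A smooth bump function\<close>

definition flat_exp :: "nat \<Rightarrow> real \<Rightarrow> real" where
  "flat_exp k x = (if x \<le> 0 then 0 else exp (- inverse x) * inverse x ^ k)"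

lemma flat_exp_tendsto_0: "(flat_exp k \<longlongrightarrow> 0) (at 0)"
proof -
  have "((\<lambda>y::real. y ^ k / exp y) \<longlongrightarrow> 0) at_top"
    by (rule tendsto_power_div_exp_0)
  then have "((\<lambda>x. inverse x ^ k / exp (inverse x)) \<longlongrightarrow> (0::real)) (at_right 0)"
    by (rule filterlim_compose[OF _ filterlim_inverse_at_top_right])
  then have "(flat_exp k \<longlongrightarrow> 0) (at_right 0)"
    by (rule Lim_transform_eventually)
      (auto simp: flat_exp_def eventually_at_filter exp_minus field_simps)
  moreover have "(flat_exp k \<longlongrightarrow> 0) (at_left 0)"
    by (rule tendsto_eventually) (auto simp: flat_exp_def eventually_at_filter)
  ultimately show ?thesis by (simp add: filterlim_split_at)
qed

text \<open>The powers of \<open>inverse x\<close> make the family closed under differentiation up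
  to linear combinations, so smoothness of every \<open>flat_exp k\<close> follows by one induction
  with \<open>k\<close> arbitrary. The case \<open>k = 0\<close> is the classical flat
  function.\<close>

lemma DERIV_flat_exp:
  "(flat_exp k has_real_derivative (flat_exp (k + 2) x - real k * flat_exp (k + 1) x)) (at x)"
proof -
  consider "x < 0" | "x = 0" | "x > 0" by linarith
  then show ?thesis
  proof cases
    case 1
    have "((\<lambda>_. 0) has_real_derivative 0) (at x)" by simp
    then have "(flat_exp k has_real_derivative 0) (at x)"
      by (rule has_field_derivative_transform_within_open[where S = "{..<0}"])
        (use 1 in \<open>auto simp: flat_exp_def\<close>)
    then show ?thesis using 1 by (simp add: flat_exp_def)
  next
    case 2
    \<comment> \<open>Away from 0 the difference quotient at 0 equals
      \<open>flat_exp (Suc k)\<close>, whose limit is already known.\<close>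
    have "((\<lambda>y. (flat_exp k y - flat_exp k 0) / (y - 0)) \<longlongrightarrow> 0) (at 0)"
      by (rule Lim_transform_eventually[OF flat_exp_tendsto_0[of "Suc k"]])
        (auto simp: flat_exp_def eventually_at_filter field_simps)
    then show ?thesis using 2 by (simp add: has_field_derivative_iff flat_exp_def)
  next
    case 3
    have "((\<lambda>y. exp (- inverse y) * inverse y ^ k) has_real_derivative
        (flat_exp (k + 2) x - real k * flat_exp (k + 1) x)) (at x)"
      using 3 by (auto intro!: derivative_eq_intros
          simp: flat_exp_def power2_eq_square field_simps)
        (cases k; simp add: field_simps)
    then show ?thesis
      by (rule has_field_derivative_transform_within_open[where S = "{0<..}"])
        (use 3 in \<open>auto simp: flat_exp_def\<close>)
  qed
qed

lemma smooth_on_flat_exp: "smooth_on UNIV (flat_exp k)"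
proof -
  have "times_differentiable_on n UNIV (flat_exp k)" for n
  proof (induction n arbitrary: k)
    case (Suc n)
    have "times_differentiable_on n UNIV
        (\<lambda>x. flat_exp (k + 2) x + (- real k) * flat_exp (k + 1) x)"
      by (intro times_differentiable_on_add times_differentiable_on_mult
          times_differentiable_on_const Suc open_UNIV)
    then show ?case
      by (intro times_differentiable_on_SucI[OF open_UNIV DERIV_flat_exp]) simp
  qed simp
  then show ?thesis by (simp add: smooth_on_def)
qed

text \<open>The exact set of positivity later turns a vanishing integral into vanishing of
  \<open>u\<close> on an interval. The bound by 1 serves an estimate of \<open>\<rho>\<close>
  squared.\<close>

lemma smooth_bump_exists:
  obtains \<rho> :: "real \<Rightarrow> real"
  where "smooth_on UNIV \<rho>" "\<And>y. 0 \<le> \<rho> y" "\<And>y. \<rho> y \<le> 1"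
    "\<And>y. 0 < \<rho> y \<longleftrightarrow> a < y \<and> y < d"
proof
  let ?f = "flat_exp 0"
  have f: "0 \<le> ?f y" "?f y \<le> 1" "0 < ?f y \<longleftrightarrow> 0 < y" for y
    by (auto simp: flat_exp_def)
  show "smooth_on UNIV (\<lambda>y. ?f (y - a) * ?f (d - y))"
    by (intro smooth_on_mult smooth_on_compose[OF smooth_on_flat_exp[of 0]] smooth_on_diff
        smooth_on_ident smooth_on_const) auto
  show "0 \<le> ?f (y - a) * ?f (d - y)" for y
    using f by simp
  show "?f (y - a) * ?f (d - y) \<le> 1" for y
    using f by (simp add: mult_le_one)
  show "0 < ?f (y - a) * ?f (d - y) \<longleftrightarrow> a < y \<and> y < d" for y
    using f(1)[of "y - a"] f(3)[of "y - a"] f(1)[of "d - y"] f(3)[of "d - y"]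
    by (auto simp: zero_less_mult_iff)
qed

subsection \<open>Test functions in the logarithmic variable\<close>

lemma real_antiderivative_exists:
  fixes f :: "real \<Rightarrow> real"
  assumes "continuous_on UNIV f"
  obtains F where "\<And>x. (F has_real_derivative f x) (at x)"
proof -
  have "\<exists>F. \<forall>x::real. (-\<infinity>) < ereal x \<longrightarrow> ereal x < \<infinity> \<longrightarrow> (F has_vector_derivative f x) (at x)"
    by (rule einterval_antiderivative)
      (use assms in \<open>auto simp: continuous_on_eq_continuous_at einterval_def\<close>)
  then show ?thesis
    using that by (auto simp: has_real_derivative_iff_has_vector_derivative)
qed

lemma smooth_on_has_derivative:
  "smooth_on S f \<Longrightarrow> x \<in> S \<Longrightarrow> (f has_real_derivative deriv f x) (at x)"
  unfolding smooth_on_def using has_derivative_deriv_if_Suc by blast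

lemma smooth_on_imp_continuous_on: "smooth_on S f \<Longrightarrow> continuous_on S f"
  by (meson smooth_on_has_derivative DERIV_isCont continuous_at_imp_continuous_on)

lemma smooth_antiderivative_exists:
  assumes "smooth_on UNIV f"
  obtains F where "\<And>x. (F has_real_derivative f x) (at x)" "smooth_on UNIV F"
  using real_antiderivative_exists[OF smooth_on_imp_continuous_on[OF assms]]
    smooth_on_antiderivative[OF open_UNIV _ assms] by metis

text \<open>The difference is the integral of \<open>f\<close> over the window from
  \<open>y - b\<close> to \<open>y\<close>. It inherits the sign of \<open>f\<close>, and it
  vanishes when the window misses the interval from \<open>p\<close> to \<open>q\<close>.\<close>

lemma shift_difference_of_antiderivative:
  fixes f F :: "real \<Rightarrow> real"
  assumes F: "\<And>x. (F has_real_derivative f x) (at x)" and "0 \<le> b"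
    and f: "\<And>y. 0 \<le> f y" "\<And>y. y \<le> p \<or> q \<le> y \<Longrightarrow> f y = 0"
  shows "0 \<le> F y - F (y - b)" and "y \<le> p \<or> q + b \<le> y \<Longrightarrow> F y - F (y - b) = 0"
proof -
  show "0 \<le> F y - F (y - b)"
    using DERIV_nonneg_imp_nondecreasing[of "y - b" y F] F f(1) \<open>0 \<le> b\<close> by fastforce
  assume y: "y \<le> p \<or> q + b \<le> y"
  have "f x = 0" if "y - b \<le> x" "x \<le> y" for x
    using f(2)[of x] y that by auto
  then have "(F has_real_derivative 0) (at x)" if "y - b \<le> x" "x \<le> y" for x
    using F[of x] that by metis
  \<comment> \<open>The constancy theorem requires a nondegenerate interval; for
    \<open>b = 0\<close> the claim is trivial.\<close>
  then have "F y = F (y - b)" if "b \<noteq> 0"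
    using DERIV_isconst_end[of "y - b" y F] \<open>0 \<le> b\<close> that
    by (smt (verit) DERIV_isCont continuous_at_imp_continuous_on atLeastAtMost_iff)
  then show "F y - F (y - b) = 0" by fastforce
qed

text \<open>Integrating \<open>(exp (-2\<delta>y) \<psi>')' = \<rho> - (1+\<epsilon>) \<rho>(\<cdot> - b) + \<epsilon> \<rho>(\<cdot> - 2b)\<close> twice gives a compactly
  supported \<open>\<psi>\<close> exactly when \<open>\<epsilon> = exp (-2\<delta>b)\<close>; each integration is a difference of shifts of one
  antiderivative, which makes \<open>\<psi> \<ge> 0\<close> evident.\<close>

lemma drift_potential_exists:
  fixes \<rho> :: "real \<Rightarrow> real" and a b d \<delta> :: real
  assumes \<rho>: "smooth_on UNIV \<rho>" "\<And>y. 0 \<le> \<rho> y" "\<And>y. y \<le> a \<or> d \<le> y \<Longrightarrow> \<rho> y = 0"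
    and "0 \<le> b"
  shows "\<exists>\<psi> \<psi>' \<psi>''. smooth_on UNIV \<psi> \<and> (\<forall>y. 0 \<le> \<psi> y) \<and>
    (\<forall>y. y \<le> a \<or> d + 2 * b \<le> y \<longrightarrow> \<psi> y = 0) \<and>
    (\<forall>y. (\<psi> has_real_derivative \<psi>' y) (at y)) \<and>
    (\<forall>y. (\<psi>' has_real_derivative \<psi>'' y) (at y)) \<and>
    (\<forall>y. \<psi>'' y - 2 * \<delta> * \<psi>' y = exp (2 * \<delta> * y) *
      (\<rho> y - (1 + exp (- 2 * \<delta> * b)) * \<rho> (y - b) + exp (- 2 * \<delta> * b) * \<rho> (y - 2 * b)))"
proof -
  obtain P where P: "\<And>y. (P has_real_derivative \<rho> y) (at y)" "smooth_on UNIV P"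
    using smooth_antiderivative_exists[OF \<rho>(1)] by blast
  define Q where "Q y = P y - P (y - b)" for y
  note Q = shift_difference_of_antiderivative[OF P(1) \<open>0 \<le> b\<close> \<rho>(2,3), folded Q_def]
  \<comment> \<open>The second window difference is taken of \<open>g\<close>: then
    \<open>exp (- 2 * \<delta> * y) * (g y - g (y - b))\<close> equals
    \<open>Q y - exp (- 2 * \<delta> * b) * Q (y - b)\<close>, and differentiating this produces the
    three translates of \<open>\<rho>\<close>.\<close>
  define g where "g y = exp (2 * \<delta> * y) * Q y" for y
  have g: "0 \<le> g y" "y \<le> a \<or> d + b \<le> y \<Longrightarrow> g y = 0" for y
    using Q by (auto simp: g_def)
  have "smooth_on UNIV g"
    unfolding g_def Q_def
    by (intro smooth_on_intros smooth_on_compose[OF P(2)]) auto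
  then obtain G where G: "\<And>y. (G has_real_derivative g y) (at y)" "smooth_on UNIV G"
    using smooth_antiderivative_exists by blast
  define g' where
    "g' y = 2 * \<delta> * g y + exp (2 * \<delta> * y) * (\<rho> y - \<rho> (y - b))" for y
  have Dg: "(g has_real_derivative g' y) (at y)" for y
    unfolding g_def Q_def g'_def
    by (rule derivative_eq_intros DERIV_chain2[OF P(1)] P(1) refl | simp add: algebra_simps)+
  show ?thesis
  proof (intro exI conjI allI impI)
    show "smooth_on UNIV (\<lambda>y. G y - G (y - b))"
      by (intro smooth_on_intros smooth_on_compose[OF G(2)] G(2)) auto
    show "0 \<le> G y - G (y - b)" for y
      by (rule shift_difference_of_antiderivative[OF G(1) \<open>0 \<le> b\<close> g])
    show "G y - G (y - b) = 0" if "y \<le> a \<or> d + 2 * b \<le> y" for y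
      by (rule shift_difference_of_antiderivative(2)[OF G(1) \<open>0 \<le> b\<close> g]) (use that in auto)
    show "((\<lambda>y. G y - G (y - b)) has_real_derivative g y - g (y - b)) (at y)" for y
      by (rule derivative_eq_intros DERIV_chain2[OF G(1)] G(1) refl | simp)+
    show "((\<lambda>y. g y - g (y - b)) has_real_derivative g' y - g' (y - b)) (at y)" for y
      by (rule derivative_eq_intros DERIV_chain2[OF Dg] Dg refl | simp)+
    show "g' y - g' (y - b) - 2 * \<delta> * (g y - g (y - b)) = exp (2 * \<delta> * y) *
      (\<rho> y - (1 + exp (- 2 * \<delta> * b)) * \<rho> (y - b) + exp (- 2 * \<delta> * b) * \<rho> (y - 2 * b))" for y
    proof -
      have "exp (2 * \<delta> * (y - b)) = exp (2 * \<delta> * y) * exp (- 2 * \<delta> * b)"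
        by (simp add: exp_add[symmetric] algebra_simps)
      moreover have "y - b - b = y - 2 * b" by simp
      ultimately show ?thesis
        by (simp add: g'_def algebra_simps)
    qed
  qed
qed

section \<open>The differential operator in the logarithmic coordinate\<close>

lemma euler_operator_identity:
  fixes H i l p0 p1 p2 \<delta> :: real
  shows "(H * i\<^sup>2 * ((1/2 - \<delta>) * l - 1/2)) * ((1/2 + (1/2 - \<delta>) * l) * p0 + p1 * l)
      + (- ((1/2 - \<delta>) * (i * l\<^sup>2)) * p0 + p1 * (i * l) * (1/2 + (1/2 - \<delta>) * l)
        + (p2 * (i * l) * l + - (i * l\<^sup>2) * p1)) * (H * i)
    = H * (i\<^sup>2 * l\<^sup>2) * (p2 - 2 * \<delta> * p1)
      - (1/4 * i\<^sup>2 + (1/4 - \<delta>\<^sup>2) * (i\<^sup>2 * l\<^sup>2)) * (H * p0)"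
  by algebra

text \<open>Write \<open>x\<close> for \<open>ln (- ln t)\<close>. In the second derivative of
  \<open>h * \<psi>(x)\<close>, the term with \<open>h''\<close> gives the potential because
  \<open>h\<close> solves the homogeneous equation. The first-order terms
  \<open>2 h' x' + h x''\<close> collapse to the drift with factor
  \<open>- 2 * \<delta>\<close>.\<close>

lemma log_substitution_derivs:
  fixes \<psi> \<psi>' \<psi>'' h \<phi>' :: "real \<Rightarrow> real" and \<delta> :: real
  assumes D1: "\<And>y. (\<psi> has_real_derivative \<psi>' y) (at y)"
    and D2: "\<And>y. (\<psi>' has_real_derivative \<psi>'' y) (at y)"
    and t: "0 < t" "t < 1"
    and h_def: "h = (\<lambda>t. exp (ln t / 2 + (1/2 - \<delta>) * ln (- ln t)))"
    and \<phi>'_def: "\<phi>' = (\<lambda>t. h t / t * ((1/2 + (1/2 - \<delta>) / ln t) * \<psi> (ln (- ln t))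
      + \<psi>' (ln (- ln t)) / ln t))"
  shows "((\<lambda>t. h t * \<psi> (ln (- ln t))) has_real_derivative \<phi>' t) (at t)"
    and "(\<phi>' has_real_derivative h t / (t\<^sup>2 * (ln t)\<^sup>2) *
      (\<psi>'' (ln (- ln t)) - 2 * \<delta> * \<psi>' (ln (- ln t)))
      - (1/4 / t\<^sup>2 + (1/4 - \<delta>\<^sup>2) / (t\<^sup>2 * (ln t)\<^sup>2)) * (h t * \<psi> (ln (- ln t)))) (at t)"
proof -
  have L: "ln t < 0" using t by simp
  have Dx: "((\<lambda>t. ln (- ln t)) has_real_derivative 1 / (t * ln t)) (at t)"
    using t L by (auto intro!: derivative_eq_intros simp: field_simps)
  have Dh: "(h has_real_derivative h t / t * (1/2 + (1/2 - \<delta>) / ln t)) (at t)"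
    unfolding h_def using t L
    by (auto intro!: derivative_eq_intros Dx simp: field_simps)
  note D1' = DERIV_chain2[OF D1 Dx] and D2' = DERIV_chain2[OF D2 Dx]
  show "((\<lambda>t. h t * \<psi> (ln (- ln t))) has_real_derivative \<phi>' t) (at t)"
    unfolding \<phi>'_def
    by (rule DERIV_cong[OF DERIV_mult[OF Dh D1']]) (use t L in \<open>simp add: field_simps\<close>)
  have Dinv: "((\<lambda>t. inverse (ln t)) has_real_derivative - (1 / (t * (ln t)\<^sup>2))) (at t)"
    using t L by (auto intro!: derivative_eq_intros simp: field_simps power2_eq_square)
  have Dq: "((\<lambda>t. h t / t) has_real_derivative h t / t\<^sup>2 * ((1/2 - \<delta>) / ln t - 1/2)) (at t)"
    by (rule DERIV_cong[OF DERIV_divide[OF Dh DERIV_ident]])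
      (use t L in \<open>auto simp: field_simps power2_eq_square\<close>)
  have Da: "((\<lambda>t. 1/2 + (1/2 - \<delta>) * inverse (ln t)) has_real_derivative
      - ((1/2 - \<delta>) / (t * (ln t)\<^sup>2))) (at t)"
    by (rule DERIV_cong[OF DERIV_add[OF DERIV_const DERIV_cmult[OF Dinv]]]) simp
  \<comment> \<open>Quotients by \<open>ln t\<close> become products with its inverse, so that the
    claim reduces to a polynomial identity.\<close>
  have \<phi>'_eq: "\<phi>' = (\<lambda>t. h t / t * ((1/2 + (1/2 - \<delta>) * inverse (ln t)) * \<psi> (ln (- ln t))
      + \<psi>' (ln (- ln t)) * inverse (ln t)))"
    by (simp only: \<phi>'_def divide_inverse)
  show "(\<phi>' has_real_derivative h t / (t\<^sup>2 * (ln t)\<^sup>2) *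
      (\<psi>'' (ln (- ln t)) - 2 * \<delta> * \<psi>' (ln (- ln t)))
      - (1/4 / t\<^sup>2 + (1/4 - \<delta>\<^sup>2) / (t\<^sup>2 * (ln t)\<^sup>2)) * (h t * \<psi> (ln (- ln t)))) (at t)"
    unfolding \<phi>'_eq
  proof (rule DERIV_cong[OF DERIV_mult[OF Dq DERIV_add[OF DERIV_mult[OF Da D1'] DERIV_mult[OF D2' Dinv]]]])
    show "h t / t\<^sup>2 * ((1/2 - \<delta>) / ln t - 1/2) * ((1/2 + (1/2 - \<delta>) * inverse (ln t)) * \<psi> (ln (- ln t))
      + \<psi>' (ln (- ln t)) * inverse (ln t)) +
      (- ((1/2 - \<delta>) / (t * (ln t)\<^sup>2)) * \<psi> (ln (- ln t)) + \<psi>' (ln (- ln t)) * (1 / (t * ln t)) * (1/2 + (1/2 - \<delta>) * inverse (ln t))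
       + (\<psi>'' (ln (- ln t)) * (1 / (t * ln t)) * inverse (ln t) + - (1 / (t * (ln t)\<^sup>2)) * \<psi>' (ln (- ln t)))) * (h t / t)
      = h t / (t\<^sup>2 * (ln t)\<^sup>2) * (\<psi>'' (ln (- ln t)) - 2 * \<delta> * \<psi>' (ln (- ln t)))
      - (1/4 / t\<^sup>2 + (1/4 - \<delta>\<^sup>2) / (t\<^sup>2 * (ln t)\<^sup>2)) * (h t * \<psi> (ln (- ln t)))"
      \<comment> \<open>The letters \<open>H\<close>, \<open>i\<close>, \<open>l\<close> are
        \<open>h t\<close> and the inverses of \<open>t\<close> and \<open>ln t\<close>;
        \<open>p0\<close>, \<open>p1\<close>, \<open>p2\<close> are the values of
        \<open>\<psi>\<close> and its two derivatives.\<close>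
      using euler_operator_identity[of "h t" "inverse t" \<delta> "inverse (ln t)" "\<psi> (ln (- ln t))"
          "\<psi>' (ln (- ln t))" "\<psi>'' (ln (- ln t))"]
      by (simp only: divide_inverse power_inverse inverse_mult_distrib mult_1_left)
  qed
qed

section \<open>Transport of cutoffs and test functions to the original variable\<close>

lemma log_coordinate_le_iff:
  fixes t y :: real
  assumes "0 < t" "t < 1"
  shows "ln (- ln t) \<le> y \<longleftrightarrow> exp (- exp y) \<le> t" and "y \<le> ln (- ln t) \<longleftrightarrow> t \<le> exp (- exp y)"
proof -
  have "ln (- ln t) \<le> y \<longleftrightarrow> - ln t \<le> exp y"
    using assms ln_le_cancel_iff[of "- ln t" "exp y"] by simp
  also have "\<dots> \<longleftrightarrow> exp (- exp y) \<le> t"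
    using assms ln_ge_iff[of t "- exp y"] by linarith
  finally show "ln (- ln t) \<le> y \<longleftrightarrow> exp (- exp y) \<le> t" .
  have "y \<le> ln (- ln t) \<longleftrightarrow> exp y \<le> - ln t"
    using assms by (intro ln_ge_iff) auto
  also have "\<dots> \<longleftrightarrow> t \<le> exp (- exp y)"
    using assms ln_le_cancel_iff[of t "exp (- exp y)"] by (simp add: le_minus_iff)
  finally show "y \<le> ln (- ln t) \<longleftrightarrow> t \<le> exp (- exp y)" .
qed

text \<open>The coordinate \<open>ln (- ln t)\<close> decreases in \<open>t\<close>, so endpoints
  swap and a translation to the right moves towards \<open>t = 0\<close>. Hence only the left end
  \<open>a\<close> has to be compared with \<open>R\<close>.\<close>

lemma log_interval_subset:
  fixes a y1 y2 R :: real
  assumes "exp (- exp a) < R" "a \<le> y1"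
  shows "{exp (- exp y2)..exp (- exp y1)} \<subseteq> {0<..<R}"
proof
  fix t assume t: "t \<in> {exp (- exp y2)..exp (- exp y1)}"
  have "exp (- exp y1) \<le> exp (- exp a)"
    using assms(2) by simp
  moreover have "0 < exp (- exp y2)"
    by simp
  ultimately have "0 < t" "t < R"
    using t assms(1) unfolding atLeastAtMost_iff by linarith+
  then show "t \<in> {0<..<R}"
    by simp
qed

lemma log_pullback_test_function:
  fixes \<psi> :: "real \<Rightarrow> real" and c :: real
  assumes \<psi>: "smooth_on UNIV \<psi>" "\<And>y. y \<le> a \<or> q \<le> y \<Longrightarrow> \<psi> y = 0"
    and "exp (- exp a) < R"
  shows "test_function_on {0<..<R} (\<lambda>t. if 0 < t \<and> t < 1
    then exp (ln t / 2 + c * ln (- ln t)) * \<psi> (ln (- ln t)) else 0)" (is "test_function_on _ ?\<phi>")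
proof -
  define p where "p = exp (- exp q)"
  define r where "r = exp (- exp a)"
  have pr: "0 < p" "p < 1" "0 < r" "r < 1" "r < R"
    using assms(3) by (auto simp: p_def r_def)
  have zero: "?\<phi> t = 0" if "t \<le> p \<or> r \<le> t" for t
    using that log_coordinate_le_iff[of t] \<psi>(2) by (auto simp: p_def r_def)
  have "smooth_on {0<..<1} (\<lambda>t. exp (ln t * (1/2) + c * ln (- ln t)) * \<psi> (ln (- ln t)))"
    by (intro smooth_on_intros smooth_on_compose[OF smooth_on_ln] smooth_on_compose[OF \<psi>(1)]) auto
  then have s1: "smooth_on {0<..<1} ?\<phi>"
    by (rule smooth_on_cong[rotated 2]) auto
  have s2: "smooth_on ({..<p} \<union> {r<..}) ?\<phi>"
  proof (rule smooth_on_cong[where f = "\<lambda>x. 0"])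
    show "0 = ?\<phi> x" if "x \<in> {..<p} \<union> {r<..}" for x
      by (rule sym, rule zero) (use that in auto)
  qed (auto intro: smooth_on_const)
  \<comment> \<open>Smoothness is local: the formula is smooth on \<open>{0<..<1}\<close>, and the
    function is zero off \<open>{p..r}\<close>. These open sets cover the line because
    \<open>0 < p\<close> and \<open>r < 1\<close>.\<close>
  have cover: "{0<..<1} \<union> ({..<p} \<union> {r<..}) = UNIV"
    using pr by auto
  have "smooth_on UNIV ?\<phi>"
    using smooth_on_Un[OF s1 s2] unfolding cover .
  then have diff: "(deriv ^^ n) ?\<phi> differentiable_on UNIV" for n
    by (auto simp: smooth_on_def times_differentiable_on_def differentiable_on_def)
  have "{t. ?\<phi> t \<noteq> 0} \<subseteq> {p..r}"
  proof
    fix t assume "t \<in> {t. ?\<phi> t \<noteq> 0}"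
    then have "?\<phi> t \<noteq> 0"
      by (simp only: mem_Collect_eq not_False_eq_True)
    then have "\<not> (t \<le> p \<or> r \<le> t)"
      by (rule contrapos_nn) (rule zero)
    then show "t \<in> {p..r}"
      by auto
  qed
  then have cl: "closure {t. ?\<phi> t \<noteq> 0} \<subseteq> {p..r}"
    by (simp add: closure_minimal)
  moreover have "compact (closure {t. ?\<phi> t \<noteq> 0})"
    using bounded_subset[OF bounded_closed_interval cl] closed_closure compact_eq_bounded_closed
    by blast
  moreover have "{p..r} \<subseteq> {0<..<R}"
    using pr by auto
  ultimately show ?thesis
    using diff unfolding test_function_on_def by blast
qed

text \<open>The coefficient \<open>c\<close> may blow up at 0 and at 1, but the cutoff confines the
  integrand to a compact \<open>K\<close> inside the interval, where \<open>c\<close> is bounded and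
  local integrability of \<open>u\<close> suffices.\<close>

lemma log_cutoff_integrable:
  fixes u c \<kappa> :: "real \<Rightarrow> real"
  assumes u: "locally_integrable_on u {0<..<R}" and "R \<le> 1" and ar: "exp (- exp a) < R"
    and c: "continuous_on {0<..<1} c"
    and \<kappa>: "continuous_on UNIV \<kappa>" "\<And>y. y \<le> a \<or> q \<le> y \<Longrightarrow> \<kappa> y = 0"
  shows "set_integrable lebesgue {0<..<R} (\<lambda>t. u t * (c t * \<kappa> (ln (- ln t))))"
proof -
  define K where "K = {exp (- exp q)..exp (- exp a)}"
  have K: "K \<subseteq> {0<..<R}" "K \<subseteq> {0<..<1}" "compact K"
    using log_interval_subset[OF ar, of a q] log_interval_subset[of a 1 a q] by (auto simp: K_def)
  have "continuous_on K (\<lambda>t. c t * \<kappa> (ln (- ln t)))"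
    using K(2) by (intro continuous_intros continuous_on_subset[OF c]
        continuous_on_compose2[OF \<kappa>(1)]) auto
  then have "set_integrable lebesgue K (\<lambda>t. (c t * \<kappa> (ln (- ln t))) * u t)"
    using u K unfolding locally_integrable_on_def
    by (intro absolutely_integrable_bounded_measurable_product_real
        continuous_imp_measurable_on_sets_lebesgue compact_imp_bounded compact_continuous_image)
      (auto simp: K_def)
  moreover have "indicator K t *\<^sub>R ((c t * \<kappa> (ln (- ln t))) * u t) =
      indicator {0<..<R} t *\<^sub>R (u t * (c t * \<kappa> (ln (- ln t))))" for t
  proof (cases "t \<in> {0<..<R} - K")
    case True
    then have "\<kappa> (ln (- ln t)) = 0"
      using log_coordinate_le_iff(1)[of t a] log_coordinate_le_iff(2)[of t q] \<open>R \<le> 1\<close>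
      by (intro \<kappa>(2)) (auto simp: K_def)
    then show ?thesis by simp
  next
    case False
    then show ?thesis using K(1) by (auto simp: indicator_def)
  qed
  ultimately show ?thesis
    unfolding set_integrable_def by (simp only:)
qed

section \<open>Testing the weak inequality with a drift potential\<close>

lemma set_lebesgue_integral_nonneg_AE:
  fixes f :: "'a \<Rightarrow> real"
  assumes "AE t in M. t \<in> A \<longrightarrow> 0 \<le> f t"
  shows "0 \<le> (LINT t:A|M. f t)"
  unfolding set_lebesgue_integral_def
  by (rule integral_nonneg_AE) (use assms in \<open>auto elim!: eventually_mono simp: indicator_def\<close>)

text \<open>The weight \<open>m t\<close> is \<open>1 / (h t * t * \<bar>ln t\<bar>)\<close>, so
  both sides are integrals of \<open>z = u / h\<close> in the logarithmic coordinate. Testing with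
  \<open>h\<close> times the drift potential cancels the potential terms up to a sign and leaves
  three translates of \<open>\<rho>\<close>. The factor 2 does not depend on
  \<open>b\<close>.\<close>

lemma bump_translate_inequality:
  fixes u \<rho> :: "real \<Rightarrow> real" and R \<alpha> \<delta> a b d :: real
  assumes R: "0 < R" "R \<le> 1" and pos: "AE t in lebesgue. t \<in> {0<..<R} \<longrightarrow> 0 \<le> u t"
    and sol: "distributional_solution R \<alpha> u"
    and \<alpha>: "1/4 - \<delta>\<^sup>2 \<le> \<alpha>" and "0 \<le> \<delta>" "0 \<le> b"
    and \<rho>: "smooth_on UNIV \<rho>" "\<And>y. 0 \<le> \<rho> y" "\<And>y. y \<le> a \<or> d \<le> y \<Longrightarrow> \<rho> y = 0"
    and ar: "exp (- exp a) < R"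
  defines "m \<equiv> (\<lambda>t. exp (- (3/2) * ln t + (\<delta> - 3/2) * ln (- ln t)))"
  shows "(LINT t:{0<..<R}|lebesgue. u t * (m t * \<rho> (ln (- ln t))))
    \<le> 2 * (LINT t:{0<..<R}|lebesgue. u t * (m t * \<rho> (ln (- ln t) - b)))"
proof -
  have u: "locally_integrable_on u {0<..<R}"
    using sol by (simp add: distributional_solution_def)
  define \<epsilon> where "\<epsilon> = exp (- 2 * \<delta> * b)"
  \<comment> \<open>The sign of \<open>\<delta>\<close> enters here: it keeps
    \<open>1 + \<epsilon>\<close> at most 2 for every translation \<open>b\<close>.\<close>
  have \<epsilon>: "0 < \<epsilon>" "\<epsilon> \<le> 1"
    using \<open>0 \<le> \<delta>\<close> \<open>0 \<le> b\<close> by (auto simp: \<epsilon>_def)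
  obtain \<psi> \<psi>' \<psi>'' where \<psi>: "smooth_on UNIV \<psi>" "\<And>y. 0 \<le> \<psi> y"
    "\<And>y. y \<le> a \<or> d + 2 * b \<le> y \<Longrightarrow> \<psi> y = 0"
    and D1: "\<And>y. (\<psi> has_real_derivative \<psi>' y) (at y)"
    and D2: "\<And>y. (\<psi>' has_real_derivative \<psi>'' y) (at y)"
    and eq: "\<And>y. \<psi>'' y - 2 * \<delta> * \<psi>' y = exp (2 * \<delta> * y) *
      (\<rho> y - (1 + exp (- 2 * \<delta> * b)) * \<rho> (y - b) + exp (- 2 * \<delta> * b) * \<rho> (y - 2 * b))"
    using drift_potential_exists[OF \<rho> \<open>0 \<le> b\<close>, where \<delta> = \<delta>] by blast
  note eq = eq[folded \<epsilon>_def]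
  define h where "h = (\<lambda>t. exp (ln t / 2 + (1/2 - \<delta>) * ln (- ln t)))"
  define \<phi> where "\<phi> t = (if 0 < t \<and> t < 1 then h t * \<psi> (ln (- ln t)) else 0)" for t
  have test: "test_function_on {0<..<R} \<phi>"
    unfolding \<phi>_def h_def by (rule log_pullback_test_function[OF \<psi>(1,3) ar])
  have \<phi>_nonneg: "0 \<le> \<phi> t" for t
    using \<psi>(2) by (simp add: \<phi>_def h_def)
  define I where "I f = (LINT t:{0<..<R}|lebesgue. f t)" for f :: "real \<Rightarrow> real"
  define S where "S s t = u t * (m t * \<rho> (ln (- ln t) - s))" for s t
  define V0 where "V0 t = t powi (-2) * u t * \<phi> t" for t
  define V1 where "V1 t = t powi (-2) * \<bar>ln t\<bar> powi (-2) * u t * \<phi> t" for t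

  \<comment> \<open>The terms \<open>V0\<close> and \<open>V1\<close> are the integrands of the weak
    inequality for \<open>\<phi>\<close>; the rest is the right-hand side of the drift
    equation.\<close>
  have \<phi>'': "u t * deriv (deriv \<phi>) t = S 0 t - (1 + \<epsilon>) * S b t + \<epsilon> * S (2 * b) t
      - 1/4 * V0 t - (1/4 - \<delta>\<^sup>2) * V1 t" if t: "t \<in> {0<..<R}" for t
  proof -
    define \<phi>' where "\<phi>' = (\<lambda>t. h t / t * ((1/2 + (1/2 - \<delta>) / ln t) * \<psi> (ln (- ln t))
      + \<psi>' (ln (- ln t)) / ln t))"
    have t': "0 < t" "t < 1" "ln t < 0" using t R by auto
    note D = log_substitution_derivs[OF D1 D2 _ _ h_def \<phi>'_def]
    \<comment> \<open>The first derivative has to be known on a neighbourhood of \<open>t\<close>,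
      not just at \<open>t\<close>, before it is differentiated again.\<close>
    have first: "deriv \<phi> s = \<phi>' s" if "s \<in> {0<..<1}" for s
    proof (rule DERIV_imp_deriv)
      have "((\<lambda>t. h t * \<psi> (ln (- ln t))) has_real_derivative \<phi>' s) (at s)"
        by (rule D(1)) (use that in auto)
      then show "(\<phi> has_real_derivative \<phi>' s) (at s)"
        by (rule has_field_derivative_transform_within_open[where S = "{0<..<1}"])
          (use that in \<open>auto simp: \<phi>_def\<close>)
    qed
    have "deriv (deriv \<phi>) t = h t / (t\<^sup>2 * (ln t)\<^sup>2) *
      (\<psi>'' (ln (- ln t)) - 2 * \<delta> * \<psi>' (ln (- ln t)))
      - (1/4 / t\<^sup>2 + (1/4 - \<delta>\<^sup>2) / (t\<^sup>2 * (ln t)\<^sup>2)) * (h t * \<psi> (ln (- ln t)))"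
      by (rule DERIV_imp_deriv, rule has_field_derivative_transform_within_open[OF D(2), where S="{0<..<1}"])
        (use t' first in auto)
    also have "h t / (t\<^sup>2 * (ln t)\<^sup>2) * (\<psi>'' (ln (- ln t)) - 2 * \<delta> * \<psi>' (ln (- ln t))) =
      (h t / (t\<^sup>2 * (ln t)\<^sup>2) * exp (2 * \<delta> * ln (- ln t))) *
      (\<rho> (ln (- ln t)) - (1 + \<epsilon>) * \<rho> (ln (- ln t) - b) + \<epsilon> * \<rho> (ln (- ln t) - 2 * b))"
      by (simp add: eq)
    also have "h t / (t\<^sup>2 * (ln t)\<^sup>2) * exp (2 * \<delta> * ln (- ln t)) = m t"
    proof -
      have "t\<^sup>2 * (ln t)\<^sup>2 = exp (2 * ln t + 2 * ln (- ln t))"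
        using t' by (simp add: exp_add exp_double)
      then show ?thesis
        by (simp add: h_def m_def exp_diff[symmetric] exp_add[symmetric] algebra_simps)
    qed
    also have "h t * \<psi> (ln (- ln t)) = \<phi> t"
      using t' by (simp add: \<phi>_def)
    finally have *: "deriv (deriv \<phi>) t = m t * (\<rho> (ln (- ln t)) - (1 + \<epsilon>) * \<rho> (ln (- ln t) - b)
        + \<epsilon> * \<rho> (ln (- ln t) - 2 * b))
        - (1/4 / t\<^sup>2 + (1/4 - \<delta>\<^sup>2) / (t\<^sup>2 * (ln t)\<^sup>2)) * \<phi> t" .
    have V: "V0 t = u t * (1 / t\<^sup>2 * \<phi> t)" "V1 t = u t * (1 / (t\<^sup>2 * (ln t)\<^sup>2) * \<phi> t)"
      by (simp_all add: V0_def V1_def power_int_minus field_simps)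
    show ?thesis
      unfolding * V S_def by (simp add: algebra_simps)
  qed

  have cont_m: "continuous_on {0<..<1} m" and cont_h: "continuous_on {0<..<1} h"
    unfolding m_def h_def by (intro continuous_intros; force)+
  \<comment> \<open>Splitting the integral requires each piece to be integrable. Shifts up to
    \<open>2 * b\<close> keep the bump between \<open>a\<close> and
    \<open>d + 2 * b\<close>.\<close>
  have intS: "set_integrable lebesgue {0<..<R} (S s)" if "0 \<le> s" "s \<le> 2 * b" for s
    unfolding S_def
    by (rule log_cutoff_integrable[OF u R(2) ar cont_m, of "\<lambda>y. \<rho> (y - s)" "d + 2 * b"])
      (use that \<rho>(3) in \<open>auto intro!: continuous_intros
        continuous_on_compose2[OF smooth_on_imp_continuous_on[OF \<rho>(1)]]\<close>)
  have int\<psi>: "set_integrable lebesgue {0<..<R} (\<lambda>t. u t * (c t * \<psi> (ln (- ln t))))"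
    if "continuous_on {0<..<1} c" for c
    by (rule log_cutoff_integrable[OF u R(2) ar that smooth_on_imp_continuous_on[OF \<psi>(1)] \<psi>(3)])
  have intV0: "set_integrable lebesgue {0<..<R} V0"
  proof -
    have "continuous_on {0<..<1} (\<lambda>t. t powi (-2) * h t)"
      by (intro continuous_intros cont_h) auto
    from int\<psi>[OF this] show ?thesis
      by (rule set_integrable_cong[THEN iffD1, rotated 3]) (use R in \<open>auto simp: V0_def \<phi>_def\<close>)
  qed
  have intV1: "set_integrable lebesgue {0<..<R} V1"
  proof -
    have "continuous_on {0<..<1} (\<lambda>t. t powi (-2) * \<bar>ln t\<bar> powi (-2) * h t)"
      by (intro continuous_intros cont_h) auto
    from int\<psi>[OF this] show ?thesis
      by (rule set_integrable_cong[THEN iffD1, rotated 3]) (use R in \<open>auto simp: V1_def \<phi>_def\<close>)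
  qed
  have I_nonneg: "0 \<le> I (\<lambda>t. c t * u t)" if "\<And>t. 0 \<le> c t" for c
    unfolding I_def by (rule set_lebesgue_integral_nonneg_AE)
      (use pos that in \<open>auto elim!: eventually_mono\<close>)
  have IS_nonneg: "0 \<le> I (S s)" for s
  proof -
    have "S s = (\<lambda>t. (m t * \<rho> (ln (- ln t) - s)) * u t)"
      by (simp add: S_def fun_eq_iff)
    then show ?thesis
      using I_nonneg[of "\<lambda>t. m t * \<rho> (ln (- ln t) - s)"] \<rho>(2) by (simp add: m_def)
  qed
  have IV1_nonneg: "0 \<le> I V1"
  proof -
    have "V1 = (\<lambda>t. (t powi (-2) * \<bar>ln t\<bar> powi (-2) * \<phi> t) * u t)"
      by (simp add: V1_def fun_eq_iff)
    then show ?thesis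
      using I_nonneg[of "\<lambda>t. t powi (-2) * \<bar>ln t\<bar> powi (-2) * \<phi> t"] \<phi>_nonneg
      by (simp add: power_int_minus)
  qed

  have "I (\<lambda>t. u t * deriv (deriv \<phi>) t) =
      I (\<lambda>t. S 0 t - (1 + \<epsilon>) * S b t + \<epsilon> * S (2 * b) t - 1/4 * V0 t - (1/4 - \<delta>\<^sup>2) * V1 t)"
    unfolding I_def by (rule set_lebesgue_integral_cong) (use \<phi>'' in auto)
  also have "\<dots> = I (S 0) - (1 + \<epsilon>) * I (S b) + \<epsilon> * I (S (2 * b)) - 1/4 * I V0 - (1/4 - \<delta>\<^sup>2) * I V1"
    unfolding I_def using intS[of 0] intS[of b] intS[of "2 * b"] intV0 intV1 \<open>0 \<le> b\<close>
    by (simp add: set_integral_diff set_integral_add set_integral_mult_right)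
  finally have "I (\<lambda>t. u t * deriv (deriv \<phi>) t) = \<dots>" .
  moreover have "- I (\<lambda>t. u t * deriv (deriv \<phi>) t) - 1/4 * I V0 \<ge> \<alpha> * I V1"
    using sol test \<phi>_nonneg unfolding distributional_solution_def I_def V0_def V1_def by blast
  \<comment> \<open>Since \<open>I V1\<close> is non-negative, \<open>\<alpha>\<close> can be
    lowered to the constant for which \<open>h\<close> is an exact solution; then
    \<open>I V0\<close> and \<open>I V1\<close> cancel.\<close>
  moreover have "(1/4 - \<delta>\<^sup>2) * I V1 \<le> \<alpha> * I V1"
    using \<alpha> IV1_nonneg by (rule mult_right_mono)
  ultimately have "I (S 0) + \<epsilon> * I (S (2 * b)) \<le> (1 + \<epsilon>) * I (S b)"
    by linarith
  moreover have "0 \<le> \<epsilon> * I (S (2 * b))" "(1 + \<epsilon>) * I (S b) \<le> 2 * I (S b)"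
    using \<epsilon> IS_nonneg by (auto intro: mult_right_mono)
  ultimately show ?thesis
    unfolding I_def S_def by simp
qed

subsection \<open>Decay of translates\<close>

text \<open>The density \<open>- (1 / (t * ln t))\<close> is Lebesgue measure of the coordinate
  \<open>ln (- ln t)\<close> pulled back to \<open>t\<close>, so the mass of a translated interval
  does not depend on the translation.\<close>

lemma log_coordinate_integral:
  fixes y1 y2 :: real
  assumes "y1 \<le> y2"
  defines "A \<equiv> {exp (- exp y2)..exp (- exp y1)}"
  shows "integrable lebesgue (\<lambda>t. indicator A t * (- (1 / (t * ln t))))"
    and "(LINT t|lebesgue. indicator A t * (- (1 / (t * ln t)))) = y2 - y1"
proof -
  have A: "0 < t" "t < 1" if "t \<in> A" for t
    using log_interval_subset[of y1 1 y1 y2] that by (auto simp: A_def)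
  have D: "((\<lambda>t. - ln (- ln t)) has_real_derivative - (1 / (t * ln t))) (at t)" if "t \<in> A" for t
    using A[OF that] by (auto intro!: derivative_eq_intros simp: field_simps)
  have G: "0 \<le> - (1 / (t * ln t))" if "t \<in> A" for t
    using A[OF that] by (simp add: divide_le_0_iff mult_le_0_iff)
  have meas: "(\<lambda>t::real. - (1 / (t * ln t))) \<in> borel_measurable borel"
    by measurable
  have bi: "has_bochner_integral lborel (\<lambda>t. - (1 / (t * ln t)) * indicator A t)
      (- ln (- ln (exp (- exp y1))) - - ln (- ln (exp (- exp y2))))"
    unfolding A_def
    by (rule has_bochner_integral_FTC_Icc_nonneg[OF meas])
      (use D G assms(1) in \<open>auto simp: A_def\<close>)
  have eq: "(\<lambda>t. - (1 / (t * ln t)) * indicator A t) = (\<lambda>t. indicator A t * (- (1 / (t * ln t))))"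
    by (simp add: mult.commute)
  have meas': "(\<lambda>t. indicator A t * (- (1 / (t * ln t)))) \<in> borel_measurable lborel"
    unfolding A_def by measurable
  show "integrable lebesgue (\<lambda>t. indicator A t * (- (1 / (t * ln t))))"
    using bi meas' unfolding eq by (simp add: integrable_completion has_bochner_integral_iff)
  show "(LINT t|lebesgue. indicator A t * (- (1 / (t * ln t)))) = y2 - y1"
    using bi meas' unfolding eq by (simp add: integral_completion has_bochner_integral_iff)
qed

text \<open>This is Young's inequality
  \<open>2 * (p * c) \<le> \<mu> * p\<^sup>2 + c\<^sup>2 / \<mu>\<close>, where \<open>p\<close> is
  \<open>u\<close> times the root of its weight and \<open>c\<^sup>2\<close> is at most the density
  of the logarithmic coordinate. The last term is therefore independent of \<open>b\<close>, and
  \<open>\<mu>\<close> stays free for a later limit.\<close>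

lemma translate_weighted_bound:
  fixes u \<rho> :: "real \<Rightarrow> real" and R \<delta> a d b \<mu> :: real
  assumes u: "locally_integrable_on u {0<..<R}" and R: "0 < R" "R \<le> 1"
    and \<rho>: "continuous_on UNIV \<rho>" "\<And>y. 0 \<le> \<rho> y" "\<And>y. \<rho> y \<le> 1"
      "\<And>y. y \<le> a \<or> d \<le> y \<Longrightarrow> \<rho> y = 0"
    and "a \<le> d" "0 \<le> b" "0 < \<mu>" and ar: "exp (- exp a) < R"
    and int: "set_integrable lebesgue {0<..<R} (\<lambda>t. (u t * exp (- ln t - (1 - \<delta>) * ln (- ln t)))\<^sup>2)"
  defines "A \<equiv> {exp (- exp (d + b))..exp (- exp (a + b))}"
  shows "2 * (LINT t:{0<..<R}|lebesgue.
      u t * (exp (- (3/2) * ln t + (\<delta> - 3/2) * ln (- ln t)) * \<rho> (ln (- ln t) - b)))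
    \<le> \<mu> * (LINT t:A|lebesgue. (u t * exp (- ln t - (1 - \<delta>) * ln (- ln t)))\<^sup>2) + (d - a) / \<mu>"
proof -
  define m where "m t = exp (- (3/2) * ln t + (\<delta> - 3/2) * ln (- ln t))" for t
  define F where "F t = (u t * exp (- ln t - (1 - \<delta>) * ln (- ln t)))\<^sup>2" for t
  define G where "G t = - (1 / (t * ln t))" for t :: real
  have AR: "A \<subseteq> {0<..<R}"
    unfolding A_def by (rule log_interval_subset[OF ar]) (use \<open>0 \<le> b\<close> in simp)
  have intF: "integrable lebesgue (\<lambda>t. indicator A t * F t)"
    using set_integrable_subset[OF int, of A] AR by (simp add: A_def F_def set_integrable_def)
  note G = log_coordinate_integral[of "a + b" "d + b", folded A_def G_def]
  have intG: "integrable lebesgue (\<lambda>t. indicator A t * G t)"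
    and G_eq: "(LINT t|lebesgue. indicator A t * G t) = d - a"
    using G \<open>a \<le> d\<close> by auto
  have "continuous_on {0<..<1} m"
    unfolding m_def by (intro continuous_intros; force)
  then have "set_integrable lebesgue {0<..<R} (\<lambda>t. u t * (m t * (\<lambda>y. \<rho> (y - b)) (ln (- ln t))))"
    by (rule log_cutoff_integrable[OF u R(2) ar, where q = "d + b"])
      (use \<rho>(4) \<open>0 \<le> b\<close> in \<open>auto intro!: continuous_intros continuous_on_compose2[OF \<rho>(1)]\<close>)
  then have intS: "integrable lebesgue (\<lambda>t. indicator {0<..<R} t * (u t * (m t * \<rho> (ln (- ln t) - b))))"
    by (simp add: set_integrable_def)
  have pt: "2 * (indicator {0<..<R} t * (u t * (m t * \<rho> (ln (- ln t) - b))))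
      \<le> \<mu> * (indicator A t * F t) + (indicator A t * G t) / \<mu>" for t
  proof (cases "t \<in> A")
    case True
    then have t: "0 < t" "t < 1" using AR R by auto
    define p where "p = u t * exp (- ln t - (1 - \<delta>) * ln (- ln t))"
    define e where "e = exp (- (1/2) * ln t - (1/2) * ln (- ln t))"
    define c where "c = e * \<rho> (ln (- ln t) - b)"
    \<comment> \<open>The exponents split as \<open>-3/2 = -1 - 1/2\<close> and
      \<open>\<delta> - 3/2 = - (1 - \<delta>) - 1/2\<close>.\<close>
    have m: "m t = exp (- ln t - (1 - \<delta>) * ln (- ln t)) * e"
      by (simp add: m_def e_def exp_add[symmetric] algebra_simps)
    have "e\<^sup>2 = exp (- (ln t + ln (- ln t)))"
      by (simp add: e_def exp_double[symmetric] algebra_simps)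
    also have "\<dots> = G t"
      unfolding G_def exp_minus exp_add using t by (simp add: divide_inverse)
    finally have e: "e\<^sup>2 = G t" .
    have "c\<^sup>2 \<le> G t"
      using \<rho>(2,3) unfolding c_def e[symmetric] power_mult_distrib
      by (intro mult_left_le) (auto intro: power_le_one)
    then have "c\<^sup>2 / \<mu> \<le> G t / \<mu>"
      using \<open>0 < \<mu>\<close> by (simp add: divide_right_mono)
    moreover have "0 \<le> (\<mu> * p - c)\<^sup>2 / \<mu>"
      using \<open>0 < \<mu>\<close> by simp
    then have "2 * (p * c) \<le> \<mu> * p\<^sup>2 + c\<^sup>2 / \<mu>"
      using \<open>0 < \<mu>\<close> by (simp add: field_simps power2_eq_square)
    moreover have "u t * (m t * \<rho> (ln (- ln t) - b)) = p * c"
      by (simp add: m p_def c_def)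
    ultimately show ?thesis
      using True AR by (auto simp: indicator_def F_def p_def)
  next
    case False
    have "\<rho> (ln (- ln t) - b) = 0" if "t \<in> {0<..<R}"
    proof -
      have "ln (- ln t) \<le> a + b \<or> d + b \<le> ln (- ln t)"
        using False that R log_coordinate_le_iff(1)[of t "a + b"] log_coordinate_le_iff(2)[of t "d + b"]
        by (auto simp: A_def)
      then show ?thesis
        by (intro \<rho>(4)) auto
    qed
    then show ?thesis
      using False by (auto simp: indicator_def)
  qed
  have "2 * (LINT t|lebesgue. indicator {0<..<R} t * (u t * (m t * \<rho> (ln (- ln t) - b)))) =
      (LINT t|lebesgue. 2 * (indicator {0<..<R} t * (u t * (m t * \<rho> (ln (- ln t) - b)))))"
    by simp
  also have "\<dots> \<le> (LINT t|lebesgue. \<mu> * (indicator A t * F t) + (indicator A t * G t) / \<mu>)"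
    using intS intF intG pt by (intro integral_mono) auto
  also have "\<dots> = \<mu> * (LINT t|lebesgue. indicator A t * F t) + (d - a) / \<mu>"
    using intF intG by (simp add: G_eq)
  finally show ?thesis
    by (simp add: set_lebesgue_integral_def m_def F_def)
qed

section \<open>Square integrability and vanishing of the solution\<close>

lemma weighted_L2_log_coordinate:
  assumes "R \<le> 1" and "u \<in> weighted_L2 {0<..<R} (\<lambda>t. t powi (-2) * \<bar>ln t\<bar> powr (-2 * \<gamma>))"
  shows "set_integrable lebesgue {0<..<R} (\<lambda>t. (u t * exp (- ln t - \<gamma> * ln (- ln t)))\<^sup>2)"
proof -
  define F where "F t = indicator {0<..<R} t * (u t * exp (- ln t - \<gamma> * ln (- ln t)))\<^sup>2" for t
  have [measurable]: "(\<lambda>t. indicator {0<..<R} t * u t) \<in> borel_measurable lebesgue"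
    and fin: "(\<integral>\<^sup>+t\<in>{0<..<R}. ennreal (\<bar>u t\<bar>\<^sup>2 * (t powi (-2) * \<bar>ln t\<bar> powr (-2 * \<gamma>))) \<partial>lebesgue) < \<infinity>"
    using assms(2) by (simp_all add: weighted_L2_def set_borel_measurable_def)
  have "(\<lambda>t::real. exp (- ln t - \<gamma> * ln (- ln t))) \<in> borel_measurable borel"
    by measurable
  then have [measurable]: "(\<lambda>t::real. exp (- ln t - \<gamma> * ln (- ln t))) \<in> borel_measurable lebesgue"
    by (simp add: measurable_completion)
  \<comment> \<open>The indicator moves inside the square because membership gives measurability
    only of \<open>u\<close> cut off to the interval.\<close>
  have "F = (\<lambda>t. ((indicator {0<..<R} t * u t) * exp (- ln t - \<gamma> * ln (- ln t)))\<^sup>2)"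
    by (auto simp: F_def indicator_def)
  also have "\<dots> \<in> borel_measurable lebesgue"
    by measurable
  finally have F: "F \<in> borel_measurable lebesgue" .
  have "ennreal (\<bar>u t\<bar>\<^sup>2 * (t powi (-2) * \<bar>ln t\<bar> powr (-2 * \<gamma>))) * indicator {0<..<R} t = ennreal (F t)" for t
  proof (cases "t \<in> {0<..<R}")
    case True
    then have t: "0 < t" "ln t < 0" using \<open>R \<le> 1\<close> by auto
    have "t powi (-2) = exp (- 2 * ln t)"
      using t by (simp add: power_int_minus exp_minus exp_double)
    moreover have "\<bar>ln t\<bar> powr (-2 * \<gamma>) = exp (-2 * \<gamma> * ln (- ln t))"
      using t by (simp add: powr_def)
    moreover have "(exp (- ln t - \<gamma> * ln (- ln t)))\<^sup>2 = exp (- 2 * ln t) * exp (-2 * \<gamma> * ln (- ln t))"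
      by (simp add: exp_double[symmetric] exp_add[symmetric] algebra_simps)
    ultimately show ?thesis
      using True by (simp add: F_def power_mult_distrib)
  qed (simp add: F_def)
  then have "(\<integral>\<^sup>+t. ennreal (F t) \<partial>lebesgue) < \<infinity>"
    using fin by simp
  then have "integrable lebesgue F"
    by (intro integrableI_nonneg F) (auto simp: F_def)
  then show ?thesis
    by (simp add: set_integrable_def F_def[abs_def])
qed

lemma vanishing_between:
  fixes R \<alpha> \<delta> p q :: real and u :: "real \<Rightarrow> real"
  assumes R: "0 < R" "R \<le> 1" and pos: "AE t in lebesgue. t \<in> {0<..<R} \<longrightarrow> 0 \<le> u t"
    and sol: "distributional_solution R \<alpha> u" and \<alpha>: "1/4 - \<delta>\<^sup>2 \<le> \<alpha>" and "0 \<le> \<delta>"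
    and int: "set_integrable lebesgue {0<..<R} (\<lambda>t. (u t * exp (- ln t - (1 - \<delta>) * ln (- ln t)))\<^sup>2)"
    and pq: "0 < p" "p < q" "q < R"
  shows "AE t in lebesgue. t \<in> {p<..<q} \<longrightarrow> u t = 0"
proof -
  \<comment> \<open>The coordinate reverses order: the left end \<open>a\<close> comes from
    \<open>q\<close> and the right end \<open>d\<close> from \<open>p\<close>.\<close>
  define a where "a = ln (- ln q)"
  define d where "d = ln (- ln p)"
  have aq: "exp (- exp a) = q" and dp: "exp (- exp d) = p"
    using pq R by (simp_all add: a_def d_def)
  have ad: "a \<le> d"
    using pq R by (simp add: a_def d_def)
  have ar: "exp (- exp a) < R"
    using aq pq by simp
  obtain \<rho> :: "real \<Rightarrow> real" where \<rho>: "smooth_on UNIV \<rho>" "\<And>y. 0 \<le> \<rho> y" "\<And>y. \<rho> y \<le> 1"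
    and \<rho>_pos: "\<And>y. 0 < \<rho> y \<longleftrightarrow> a < y \<and> y < d"
    using smooth_bump_exists by blast
  have \<rho>0: "\<rho> y = 0" if "y \<le> a \<or> d \<le> y" for y
    using \<rho>(2)[of y] \<rho>_pos[of y] that by linarith
  have u: "locally_integrable_on u {0<..<R}"
    using sol by (simp add: distributional_solution_def)
  define m where "m t = exp (- (3/2) * ln t + (\<delta> - 3/2) * ln (- ln t))" for t
  define F where "F t = (u t * exp (- ln t - (1 - \<delta>) * ln (- ln t)))\<^sup>2" for t
  define A where "A n = {exp (- exp (d + real n))..exp (- exp (a + real n))}" for n
  define S where "S t = indicator {0<..<R} t * (u t * (m t * \<rho> (ln (- ln t))))" for t
  define I where "I = (LINT t|lebesgue. S t)"

  have bound: "I \<le> \<mu> * (LINT t:A n|lebesgue. F t) + (d - a) / \<mu>" if "0 < \<mu>" for \<mu> n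
  proof -
    have "I \<le> 2 * (LINT t:{0<..<R}|lebesgue. u t * (m t * \<rho> (ln (- ln t) - real n)))"
      using bump_translate_inequality[where a = a and d = d and b = "real n",
          OF R pos sol \<alpha> \<open>0 \<le> \<delta>\<close> _ \<rho>(1,2) \<rho>0 ar]
      by (simp add: I_def S_def m_def set_lebesgue_integral_def)
    also have "\<dots> \<le> \<mu> * (LINT t:A n|lebesgue. F t) + (d - a) / \<mu>"
      unfolding m_def F_def A_def
      by (rule translate_weighted_bound[OF u R smooth_on_imp_continuous_on[OF \<rho>(1)] \<rho>(2,3) \<rho>0
            ad _ that ar int]) auto
    finally show ?thesis .
  qed
  have intF: "integrable lebesgue (\<lambda>t. indicator {0<..<R} t * F t)"
    using int by (simp add: set_integrable_def F_def)
  have AR: "A n \<subseteq> {0<..<R}" for n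
    unfolding A_def by (rule log_interval_subset[OF ar]) simp
  \<comment> \<open>The sets \<open>A n\<close> move towards 0, so each \<open>t\<close> lies in
    only finitely many of them, and the integrable function \<open>F\<close> dominates.\<close>
  have "(\<lambda>n. LINT t|lebesgue. indicator (A n) t * (indicator {0<..<R} t * F t)) \<longlonglongrightarrow> (LINT (t::real)|lebesgue. 0)"
  proof (rule integral_dominated_convergence[where w = "\<lambda>t. indicator {0<..<R} t * F t"])
    show "(\<lambda>t. indicator (A n) t * (indicator {0<..<R} t * F t)) \<in> borel_measurable lebesgue" for n
      by (rule borel_measurable_times[OF _ borel_measurable_integrable[OF intF]])
        (auto simp: A_def intro!: borel_measurable_indicator)
    have "(\<lambda>n. indicator (A n) t * (indicator {0<..<R} t * F t)) \<longlonglongrightarrow> 0" for t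
    proof (cases "0 < t")
      case True
      have "(\<lambda>n. exp (- exp (a + real n))) \<longlonglongrightarrow> 0"
        by real_asymp
      then have "\<forall>\<^sub>F n in sequentially. exp (- exp (a + real n)) < t"
        using True by (rule order_tendstoD)
      then show ?thesis
        by (intro tendsto_eventually) (auto elim!: eventually_mono simp: A_def indicator_def)
    qed simp
    then show "AE t in lebesgue. (\<lambda>n. indicator (A n) t * (indicator {0<..<R} t * F t)) \<longlonglongrightarrow> 0"
      by simp
    show "AE t in lebesgue. norm (indicator (A n) t * (indicator {0<..<R} t * F t))
        \<le> indicator {0<..<R} t * F t" for n
      by (auto simp: indicator_def F_def)
  qed (use intF in simp_all)
  moreover have "indicator (A n) t * (indicator {0<..<R} t * F t) = indicator (A n) t *\<^sub>R F t" for n t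
    using AR[of n] by (auto simp: indicator_def)
  ultimately have lim: "(\<lambda>n. LINT t:A n|lebesgue. F t) \<longlonglongrightarrow> 0"
    by (simp add: set_lebesgue_integral_def)
  \<comment> \<open>The order of limits matters: first \<open>n\<close> grows with
    \<open>\<mu>\<close> fixed, which removes the integral over \<open>A n\<close>; afterwards
    \<open>\<mu>\<close> grows and removes the remaining term.\<close>
  have I_le: "I \<le> (d - a) / \<mu>" if "0 < \<mu>" for \<mu>
  proof -
    have "(\<lambda>n. \<mu> * (LINT t:A n|lebesgue. F t) + (d - a) / \<mu>) \<longlonglongrightarrow> \<mu> * 0 + (d - a) / \<mu>"
      by (intro tendsto_intros lim)
    then show ?thesis
      using bound[OF that] LIMSEQ_le_const by fastforce
  qed
  have "((\<lambda>\<mu>. (d - a) / \<mu>) \<longlongrightarrow> 0) at_top"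
    by real_asymp
  then have "I \<le> 0"
    by (rule tendsto_lowerbound)
      (use I_le in \<open>auto intro: eventually_mono[OF eventually_gt_at_top[of 0]]\<close>)
  have S_nonneg: "AE t in lebesgue. 0 \<le> S t"
    using pos by eventually_elim (use \<rho>(2) in \<open>auto simp: S_def indicator_def m_def\<close>)
  have "continuous_on {0<..<1} m"
    unfolding m_def by (intro continuous_intros; force)
  then have intS: "integrable lebesgue S"
    using log_cutoff_integrable[OF u R(2) ar _ smooth_on_imp_continuous_on[OF \<rho>(1)] \<rho>0]
    by (simp add: set_integrable_def S_def[abs_def])
  have "I = 0"
    using \<open>I \<le> 0\<close> integral_nonneg_AE[OF S_nonneg] by (simp add: I_def)
  then have "AE t in lebesgue. S t = 0"
    using integral_nonneg_eq_0_iff_AE[OF intS S_nonneg] by (simp add: I_def)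
  then show ?thesis
  proof eventually_elim
    case (elim t)
    show ?case
    proof
      assume t: "t \<in> {p<..<q}"
      then have "\<not> ln (- ln t) \<le> a" "\<not> d \<le> ln (- ln t)"
        using pq R log_coordinate_le_iff[of t] by (auto simp: aq dp)
      then have "0 < \<rho> (ln (- ln t))"
        by (simp add: \<rho>_pos)
      then show "u t = 0"
        using elim t pq by (auto simp: S_def m_def)
    qed
  qed
qed

theorem theorem2p2:
  fixes R \<alpha> :: real and u :: "real \<Rightarrow> real"
  assumes "0 < R" and "R \<le> 1"
    and "AE t in lebesgue. t \<in> {0<..<R} \<longrightarrow> 0 \<le> u t"
    and "distributional_solution R \<alpha> u"
    and "\<exists>\<gamma>\<le>1. u \<in> weighted_L2 {0<..<R} (\<lambda>t. t powi (-2) * \<bar>ln t\<bar> powr (-2 * \<gamma>))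
                 \<and> \<alpha> \<ge> 1/4 - (1 - \<gamma>)\<^sup>2"
  shows "AE t in lebesgue. t \<in> {0<..<R} \<longrightarrow> u t = 0"
proof -
  obtain \<gamma> where "\<gamma> \<le> 1" and \<alpha>: "1/4 - (1 - \<gamma>)\<^sup>2 \<le> \<alpha>"
    and L2: "u \<in> weighted_L2 {0<..<R} (\<lambda>t. t powi (-2) * \<bar>ln t\<bar> powr (-2 * \<gamma>))"
    using assms(5) by blast
  \<comment> \<open>The choice \<open>\<delta> = 1 - \<gamma>\<close> is inserted, so
    \<open>1 - \<delta>\<close> is again \<open>\<gamma>\<close>.\<close>
  have int: "set_integrable lebesgue {0<..<R}
      (\<lambda>t. (u t * exp (- ln t - (1 - (1 - \<gamma>)) * ln (- ln t)))\<^sup>2)"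
    using weighted_L2_log_coordinate[OF assms(2) L2] by simp
  \<comment> \<open>The conditions on \<open>p\<close> and \<open>q\<close> sit inside the
    almost-everywhere statement so that the countably many exceptional sets for rational endpoints
    can be combined into one null set.\<close>
  have "AE t in lebesgue. 0 < p \<longrightarrow> p < q \<longrightarrow> q < R \<longrightarrow> t \<in> {p<..<q} \<longrightarrow> u t = 0" for p q :: real
    using vanishing_between[OF assms(1-4) \<alpha> _ int, of p q] \<open>\<gamma> \<le> 1\<close>
    by (cases "0 < p \<and> p < q \<and> q < R") auto
  then have "AE t in lebesgue. \<forall>p q :: rat. 0 < real_of_rat p \<longrightarrow> real_of_rat p < real_of_rat q \<longrightarrow>
      real_of_rat q < R \<longrightarrow> t \<in> {real_of_rat p<..<real_of_rat q} \<longrightarrow> u t = 0"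
    by (simp only: AE_all_countable) blast
  then show ?thesis
  proof eventually_elim
    case (elim t)
    show ?case
    proof
      assume t: "t \<in> {0<..<R}"
      obtain p where "0 < real_of_rat p" "real_of_rat p < t"
        using of_rat_dense[of 0 t] t by auto
      moreover obtain q where "t < real_of_rat q" "real_of_rat q < R"
        using of_rat_dense[of t R] t by auto
      ultimately show "u t = 0"
        using elim[rule_format, of p q] by auto
    qed
  qed
qed

end
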